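(* For $a,b,c\in\mathbb{N}$, the polynomial $T(q)=[a]_q[b]_q[c]_{q^2}$ is symmetric and unimodal if and only if $2c\le a+b$, or $a$ is even, or $b$ is even.
   Context: $\mathbb{N}$ denotes the positive integers. For a positive integer $n$, $[n]_q := 1+q+\dots+q^{n-1}$ and $[n]_{q^r} := 1+q^r+q^{2r}+\dots+q^{r(n-1)}$. A polynomial $\sum_{k=0}^N c_k q^k$ of degree $N$ is symmetric if $c_k=c_{N-k}$ for all $k$, and unimodal if there is an $M$ with $c_0\le c_1\le\dots\le c_{M-1}\le c_M\ge c_{M+1}\ge\dots\ge c_N$. *)

theory Defs
  imports "HOL-Computational_Algebra.Polynomial"
begin

(* q_bracket r n is [n]_{q^r} = 1 + q^r + ... + q^(r(n-1)); so [n]_q is q_bracket 1 n. *)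
definition q_bracket :: "nat \<Rightarrow> nat \<Rightarrow> int poly" where
  "q_bracket r n = (\<Sum>i<n. monom 1 (r * i))"

definition symmetric_poly :: "int poly \<Rightarrow> bool" where
  "symmetric_poly p \<longleftrightarrow> (\<forall>k\<le>degree p. coeff p k = coeff p (degree p - k))"

definition unimodal_poly :: "int poly \<Rightarrow> bool" where
  "unimodal_poly p \<longleftrightarrow>
     (\<exists>M\<le>degree p.
        (\<forall>k<M. coeff p k \<le> coeff p (Suc k)) \<and>
        (\<forall>k\<in>{M..<degree p}. coeff p k \<ge> coeff p (Suc k)))"

end

theory Submission
  imports Defs
begin

text \<open>
  Every factor of \<open>T\<close> is palindromic, hence so is \<open>T\<close>, and a palindromic polynomial is unimodal
  exactly when its coefficients do not decrease up to the middle. So everything depends on the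
  signs of the coefficients of \<open>(1 - q) T\<close> in the first half.

  Since \<open>(1 - q) [n]_q = 1 - q^n\<close>, the polynomial \<open>(1 - q) T\<close> is the product of \<open>1 - q^a\<close>,
  \<open>1 - q^b\<close> and the power series \<open>[c]_{q^2} / (1 - q)\<close>, and the coefficient of \<open>q^x\<close> in the last
  factor is \<open>G(x)\<close>, the number of \<open>j\<close> in \<open>{0..<c}\<close> with \<open>2 j \<le> x\<close>. Hence the coefficient of \<open>q^x\<close> in \<open>(1 - q) T\<close> is
  \<open>G(x) - G(x - a) - G(x - b) + G(x - a - b)\<close> (lemma \<open>coeff_diff_triple_product\<close>), and what remains
  is integer arithmetic.

  If \<open>a\<close> is even, the first difference \<open>G(x) - G(x - a)\<close> depends on \<open>x div 2\<close> only, as a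
  trapezoid, which is symmetric and unimodal. In the first half of the degrees, \<open>x div 2\<close> is not
  further from the centre of the trapezoid than \<open>(x - b) div 2\<close>, so the sign is right; this
  is \<open>trapezoid_mono\<close>. The case of even \<open>b\<close> is the same by symmetry of the formula.

  If \<open>a\<close> and \<open>b\<close> are odd and \<open>2 c \<le> a + b\<close>, the term \<open>G(x - a - b)\<close> vanishes throughout the first
  half, and \<open>G(x - a) + G(x - b)\<close>, which grows like \<open>x\<close>, is still at most \<open>G(x)\<close>; see
  \<open>diff_nonneg_if_odd\<close>. If \<open>a\<close> and \<open>b\<close> are odd and \<open>2 c > a + b\<close>, then
  at \<open>x = a + b - 1\<close>, which is still in the first half, no count is cut off by \<open>c\<close>, and rounding
  makes the expression equal to \<open>-1\<close>: unimodality fails there.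
\<close>

section \<open>Palindromic polynomials\<close>

text \<open>Reflection is multiplicative over a domain, so this form makes symmetry of a product
  immediate from symmetry of its factors.\<close>

lemma symmetric_poly_iff_reflect_poly: "symmetric_poly p \<longleftrightarrow> reflect_poly p = p"
proof -
  have "coeff (reflect_poly p) k = coeff p k \<longleftrightarrow>
      (k \<le> degree p \<longrightarrow> coeff p k = coeff p (degree p - k))" for k
  proof (cases "k \<le> degree p")
    case True
    then show ?thesis by (simp add: coeff_reflect_poly eq_commute)
  next
    case False
    then show ?thesis by (simp add: coeff_reflect_poly coeff_eq_0)
  qed
  then show ?thesis
    by (simp only: symmetric_poly_def poly_eq_iff)
qed

lemma symmetric_poly_mult:
  "symmetric_poly p \<Longrightarrow> symmetric_poly q \<Longrightarrow> symmetric_poly (p * q)"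
  by (simp add: symmetric_poly_iff_reflect_poly reflect_poly_mult)

text \<open>If the peak \<open>M\<close> lay before the middle, the coefficients would decrease weakly from \<open>k \<ge> M\<close> to
  the mirror image of \<open>k\<close>, where the same value is taken, so they are constant in between. Hence
  the middle can always serve as the peak.\<close>

lemma unimodal_poly_iff_first_half:
  assumes "symmetric_poly p"
  shows "unimodal_poly p \<longleftrightarrow> (\<forall>k. 2 * Suc k \<le> degree p \<longrightarrow> coeff p k \<le> coeff p (Suc k))"
proof -
  have sym: "coeff p (degree p - k) = coeff p k" if "k \<le> degree p" for k
    using assms that unfolding symmetric_poly_def by metis
  show ?thesis
  proof
    assume "unimodal_poly p"
    then obtain M where up: "\<And>k. k < M \<Longrightarrow> coeff p k \<le> coeff p (Suc k)"
      and down: "\<And>k. M \<le> k \<Longrightarrow> k < degree p \<Longrightarrow> coeff p (Suc k) \<le> coeff p k"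
      unfolding unimodal_poly_def by (metis atLeastLessThan_iff)
    show "\<forall>k. 2 * Suc k \<le> degree p \<longrightarrow> coeff p k \<le> coeff p (Suc k)"
    proof (intro allI impI)
      fix k assume k: "2 * Suc k \<le> degree p"
      show "coeff p k \<le> coeff p (Suc k)"
      proof (cases "k < M")
        case False
        have "coeff p n \<le> coeff p (Suc k)" if "Suc k \<le> n" "n \<le> degree p" for n
          using that
        proof (induction n rule: dec_induct)
          case (step n)
          then show ?case using down[of n] False by auto
        qed simp
        from this[of "degree p - k"] show ?thesis
          using sym[of k] k by simp
      qed (simp add: up)
    qed
  next
    assume up: "\<forall>k. 2 * Suc k \<le> degree p \<longrightarrow> coeff p k \<le> coeff p (Suc k)"
    have "coeff p (Suc k) \<le> coeff p k" if k: "degree p div 2 \<le> k" "k < degree p" for k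
    proof -
      define l where "l = degree p - Suc k"
      have mirror: "coeff p (Suc k) = coeff p l" "coeff p k = coeff p (Suc l)"
        using sym[of "Suc k"] sym[of k] k by (simp_all add: l_def Suc_diff_Suc)
      show ?thesis
      proof (cases "degree p \<le> 2 * k")
        case True
        then show ?thesis using up k by (simp add: mirror l_def)
      next
        \<comment> \<open>The degree is odd, and the two middle coefficients are \<open>k\<close> and \<open>Suc k\<close>.\<close>
        case False
        then have "l = k" using k by (simp add: l_def)
        then show ?thesis using mirror by simp
      qed
    qed
    then show "unimodal_poly p"
      unfolding unimodal_poly_def using up by (intro exI[of _ "degree p div 2"]) auto
  qed
qed

section \<open>q-brackets\<close>

lemma coeff_q_bracket:
  assumes "r \<ge> 1"
  shows "coeff (q_bracket r n) k = (if r dvd k \<and> k < r * n then 1 else 0)"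
proof (cases "r dvd k")
  case True
  then obtain m where m: "k = r * m" by auto
  have "coeff (q_bracket r n) k = (\<Sum>i<n. if i = m then 1 else 0)"
    unfolding q_bracket_def coeff_sum m using assms by (intro sum.cong) auto
  then show ?thesis using assms m by simp
next
  case False
  then show ?thesis
    unfolding q_bracket_def coeff_sum by (auto intro!: sum.neutral)
qed

lemma degree_q_bracket:
  assumes "r \<ge> 1" "n \<ge> 1"
  shows "degree (q_bracket r n) = r * (n - 1)"
proof (rule order_antisym)
  have "k \<le> r * (n - 1)" if "r dvd k" "k < r * n" for k
    using that by (auto simp: dvd_def)
  then show "degree (q_bracket r n) \<le> r * (n - 1)"
    using assms by (intro degree_le) (force simp: coeff_q_bracket)
  show "r * (n - 1) \<le> degree (q_bracket r n)"
    using assms by (intro le_degree) (simp add: coeff_q_bracket)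
qed

lemma symmetric_q_bracket:
  assumes "r \<ge> 1" "n \<ge> 1"
  shows "symmetric_poly (q_bracket r n)"
proof -
  have "r dvd r * (n - 1) - k \<longleftrightarrow> r dvd k" if "k \<le> r * (n - 1)" for k
    using that by (metis dvd_diff_nat dvd_triv_left diff_diff_cancel)
  moreover have "r * (n - 1) - k < r * n" for k
    by (rule le_less_trans[of _ "r * (n - 1)"]) (use assms in auto)
  ultimately show ?thesis
    using assms
    by (auto simp: symmetric_poly_def degree_q_bracket coeff_q_bracket
        simp del: mult_less_cancel1)
qed

lemma one_minus_q_times_q_bracket:
  "[:1, -1:] * q_bracket 1 n = 1 - monom 1 n"
proof (induction n)
  case (Suc n)
  have "[:1, -1:] * monom 1 n = monom 1 n - monom (1::int) (Suc n)"
    by (simp add: monom_Suc)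
  moreover have "q_bracket 1 (Suc n) = q_bracket 1 n + monom 1 n"
    by (simp add: q_bracket_def)
  ultimately show ?case using Suc by (simp add: distrib_left del: mult_pCons_left)
qed (simp add: q_bracket_def)

section \<open>Coefficients of the differenced product\<close>

text \<open>Integer indices, with the value 0 at the negative ones, let shifts by \<open>a\<close> and \<open>b\<close> be written
  without case distinctions.\<close>

definition zcoeff :: "int poly \<Rightarrow> int \<Rightarrow> int" where
  "zcoeff p x = (if x < 0 then 0 else coeff p (nat x))"

lemma zcoeff_q_bracket_mult_diff:
  "zcoeff (q_bracket 1 n * p) x - zcoeff (q_bracket 1 n * p) (x - 1)
     = zcoeff p x - zcoeff p (x - int n)"
proof -
  let ?S = "q_bracket 1 n * p"
  have "?S - pCons 0 ?S = [:1, -1:] * ?S" by simp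
  also have "\<dots> = p - monom 1 n * p"
    by (simp only: mult.assoc[symmetric] one_minus_q_times_q_bracket left_diff_distrib mult_1_left)
  finally have "coeff (?S - pCons 0 ?S) (nat x) = coeff (p - monom 1 n * p) (nat x)"
    by simp
  then show ?thesis
    by (auto simp: zcoeff_def coeff_pCons coeff_monom_mult nat_diff_distrib' nat_less_iff
        not_less split: nat.splits)
qed

text \<open>The function \<open>F\<close> is the sequence of coefficients of \<open>p / (1 - q)\<close>, and multiplication by
  \<open>[n]_q\<close> is multiplication of that series by \<open>1 - q^n\<close>.\<close>

lemma zcoeff_q_bracket_mult:
  assumes neg: "\<And>x. x < 0 \<Longrightarrow> F x = 0"
    and diff: "\<And>x. x \<ge> 0 \<Longrightarrow> F x - F (x - 1) = zcoeff p x"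
  shows "zcoeff (q_bracket 1 n * p) x = F x - F (x - int n)"
proof (cases "x \<ge> -1")
  case True
  then show ?thesis
  proof (induction x rule: int_ge_induct)
    case base
    then show ?case by (simp add: neg zcoeff_def)
  next
    case (step x)
    have d: "F y - F (y - 1) = zcoeff p y" for y
      by (cases "y \<ge> 0") (simp_all add: diff neg zcoeff_def)
    show ?case
      using step zcoeff_q_bracket_mult_diff[of n p "x + 1"] d[of "x + 1"] d[of "x + 1 - int n"]
      by (simp add: algebra_simps)
  qed
qed (simp add: neg zcoeff_def)

text \<open>The number of \<open>j\<close> in \<open>{0..<c}\<close> with \<open>j \<le> u\<close>.\<close>

definition clamped_count :: "int \<Rightarrow> int \<Rightarrow> int" where
  "clamped_count c u = max 0 (min c (u + 1))"

lemma clamped_count_half_diff: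
  assumes "x \<ge> 0"
  shows "clamped_count (int c) (x div 2) - clamped_count (int c) ((x - 1) div 2)
           = zcoeff (q_bracket 2 c) x"
proof (cases "even x")
  case True
  then obtain z where "x = 2 * z" by auto
  then show ?thesis
    using assms by (auto simp: clamped_count_def zcoeff_def coeff_q_bracket even_nat_iff)
next
  case False
  then obtain z where "x = 2 * z + 1" by (auto elim: oddE)
  then show ?thesis
    using assms by (auto simp: zcoeff_def coeff_q_bracket even_nat_iff)
qed

lemma coeff_diff_triple_product:
  fixes a b c :: nat and x :: int
  defines "T \<equiv> q_bracket 1 a * q_bracket 1 b * q_bracket 2 c"
    and "G \<equiv> \<lambda>x. clamped_count (int c) (x div 2)"
  shows "zcoeff T x - zcoeff T (x - 1) = G x - G (x - a) - G (x - b) + G (x - a - b)"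
proof -
  have neg: "G x = 0" if "x < 0" for x
    using that by (auto simp: G_def clamped_count_def)
  have diff: "G x - G (x - 1) = zcoeff (q_bracket 2 c) x" if "x \<ge> 0" for x
    using that by (simp add: G_def clamped_count_half_diff)
  have "zcoeff (q_bracket 1 b * q_bracket 2 c) y = G y - G (y - b)" for y
    by (rule zcoeff_q_bracket_mult[OF neg diff])
  then show ?thesis
    unfolding T_def mult.assoc zcoeff_q_bracket_mult_diff by simp
qed

section \<open>The sign of the differences\<close>

text \<open>As a function of \<open>u\<close>, the difference is a trapezoid: it rises with slope 1, is constant, and
  falls with slope \<open>-1\<close>, symmetrically about \<open>(m + c - 2) / 2\<close>. The hypotheses say that \<open>v\<close> is left
  of \<open>u\<close> and at least as far from that centre.\<close>

lemma trapezoid_mono: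
  assumes "v \<le> u" "u + v \<le> m + c - 2" "m \<ge> 0" "c \<ge> 0"
  shows "clamped_count c v - clamped_count c (v - m) \<le> clamped_count c u - clamped_count c (u - m)"
  using assms unfolding clamped_count_def by (smt (verit))

lemma diff_nonneg_if_even:
  fixes a b c x :: int
  defines "G \<equiv> \<lambda>x. clamped_count c (x div 2)"
  assumes "even a" "a \<ge> 0" "b \<ge> 0" "c \<ge> 0" and x: "2 * x \<le> a + b + 2 * c - 4"
  shows "G x - G (x - a) - G (x - b) + G (x - a - b) \<ge> 0"
proof -
  obtain m where m: "a = 2 * m" using \<open>even a\<close> by auto
  have "x div 2 + (x - b) div 2 \<le> m + c - 2" using x m by linarith
  then have "clamped_count c ((x - b) div 2) - clamped_count c ((x - b) div 2 - m)
      \<le> clamped_count c (x div 2) - clamped_count c (x div 2 - m)"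
    using assms m by (intro trapezoid_mono) (auto intro: zdiv_mono1)
  moreover have "(x - a) div 2 = x div 2 - m" "(x - a - b) div 2 = (x - b) div 2 - m"
    using m by linarith+
  ultimately show ?thesis by (simp add: G_def)
qed

text \<open>The bounds give \<open>x \<le> a + b - 2\<close>, so the last term is 0. If \<open>x < a\<close> or \<open>x < b\<close>, at most one
  negative term remains, and \<open>G\<close> is monotone. Otherwise, counting without the limit \<open>c\<close>,
  \<open>G (x - a) + G (x - b)\<close> is at most \<open>x - (a + b) / 2 + 2\<close>, and one less if \<open>x\<close> is even. The degree
  bound makes this at most \<open>c\<close>, and \<open>x \<le> a + b - 2\<close> makes it at most \<open>x div 2 + 1\<close>; the smaller
  of these two is \<open>G x\<close>.\<close>

lemma diff_nonneg_if_odd: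
  fixes a b c x :: int
  defines "G \<equiv> \<lambda>x. clamped_count c (x div 2)"
  assumes "odd a" "odd b" "a \<ge> 1" "b \<ge> 1" "x \<ge> 0" "2 * c \<le> a + b"
    and x: "2 * x \<le> a + b + 2 * c - 4"
  shows "G x - G (x - a) - G (x - b) + G (x - a - b) \<ge> 0"
proof -
  obtain m n where m: "a = 2 * m + 1" and n: "b = 2 * n + 1"
    using assms by (auto elim!: oddE)
  show ?thesis
  proof (cases "even x")
    case True
    then obtain z where z: "x = 2 * z" by auto
    have "x div 2 = z" "(x - a) div 2 = z - m - 1" "(x - b) div 2 = z - n - 1"
      "(x - a - b) div 2 = z - m - n - 1"
      unfolding z m n by linarith+
    then show ?thesis
      using assms z m n unfolding G_def clamped_count_def by (smt (verit))
  next
    case False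
    then obtain z where z: "x = 2 * z + 1" by (auto elim: oddE)
    have "x div 2 = z" "(x - a) div 2 = z - m" "(x - b) div 2 = z - n"
      "(x - a - b) div 2 = z - m - n - 1"
      unfolding z m n by linarith+
    then show ?thesis
      using assms z m n unfolding G_def clamped_count_def by (smt (verit))
  qed
qed

text \<open>Here the counts are \<open>(a + b) / 2\<close>, \<open>(b + 1) / 2\<close>, \<open>(a + 1) / 2\<close> and 0.\<close>

lemma diff_negative_if_odd:
  fixes a b c :: int
  defines "G \<equiv> \<lambda>x. clamped_count c (x div 2)"
  assumes "odd a" "odd b" "a \<ge> 1" "b \<ge> 1" "2 * c > a + b" and x: "x = a + b - 1"
  shows "G x - G (x - a) - G (x - b) + G (x - a - b) = -1"
proof -
  obtain m n where m: "a = 2 * m + 1" and n: "b = 2 * n + 1"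
    using assms by (auto elim!: oddE)
  have "x div 2 = m + n" "(x - a) div 2 = n" "(x - b) div 2 = m" "(x - a - b) div 2 = -1"
    unfolding x m n by linarith+
  then show ?thesis
    using assms m n unfolding G_def clamped_count_def by (smt (verit))
qed

section \<open>Unimodality of the product\<close>

theorem proposition1p3:
  fixes a b c :: nat
  assumes "a \<ge> 1" and "b \<ge> 1" and "c \<ge> 1"
  defines "T \<equiv> q_bracket 1 a * q_bracket 1 b * q_bracket 2 c"
  shows "symmetric_poly T \<and> unimodal_poly T \<longleftrightarrow> 2 * c \<le> a + b \<or> even a \<or> even b"
proof -
  let ?G = "\<lambda>x. clamped_count (int c) (x div 2)"
  let ?D = "\<lambda>x. ?G x - ?G (x - a) - ?G (x - b) + ?G (x - a - b)"
  have sym: "symmetric_poly T"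
    unfolding T_def using assms by (intro symmetric_poly_mult symmetric_q_bracket) auto
  have nonzero: "q_bracket r n \<noteq> 0" if "r \<ge> 1" "n \<ge> 1" for r n
    using that coeff_q_bracket[of r n 0] by auto
  have deg: "degree T = (a - 1) + (b - 1) + 2 * (c - 1)"
    unfolding T_def using assms by (simp add: degree_mult_eq nonzero degree_q_bracket)
  have diff: "coeff T (Suc k) - coeff T k = ?D (int (Suc k))" for k
    using coeff_diff_triple_product[of a b c "int (Suc k)"]
    by (simp add: T_def zcoeff_def nat_add_distrib)
  have "(\<forall>k. 2 * Suc k \<le> degree T \<longrightarrow> coeff T k \<le> coeff T (Suc k))
      \<longleftrightarrow> 2 * c \<le> a + b \<or> even a \<or> even b" (is "?mono \<longleftrightarrow> ?cond")
  proof
    assume ?mono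
    show ?cond
    proof (rule ccontr)
      assume neg: "\<not> ?cond"
      then obtain m n where mn: "a = 2 * m + 1" "b = 2 * n + 1" by (auto elim!: oddE)
      then have "c \<ge> m + n + 2" using neg by linarith
      then have "2 * Suc (a + b - 2) \<le> degree T"
        unfolding deg mn by simp
      then have "coeff T (a + b - 2) \<le> coeff T (Suc (a + b - 2))"
        using \<open>?mono\<close> by blast
      then have "0 \<le> ?D (int (Suc (a + b - 2)))"
        unfolding diff[symmetric] by simp
      moreover have "?D (int (Suc (a + b - 2))) = -1"
        using neg assms by (intro diff_negative_if_odd) auto
      ultimately show False by simp
    qed
  next
    assume cond: ?cond
    show ?mono
    proof (intro allI impI)
      fix k assume "2 * Suc k \<le> degree T"
      then have half: "2 * int (Suc k) \<le> int a + int b + 2 * int c - 4"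
        using assms(1-3) unfolding deg by linarith
      consider "even a" | "even b" | "odd a" "odd b" "2 * c \<le> a + b"
        using cond by blast
      then have "?D (int (Suc k)) \<ge> 0"
      proof cases
        case 1
        then show ?thesis
          using half by (intro diff_nonneg_if_even) auto
      next
        case 2
        then have "?G (int (Suc k)) - ?G (int (Suc k) - b) - ?G (int (Suc k) - a)
            + ?G (int (Suc k) - b - a) \<ge> 0"
          using half by (intro diff_nonneg_if_even) auto
        then show ?thesis by (simp add: algebra_simps)
      next
        case 3
        then show ?thesis
          using half assms by (intro diff_nonneg_if_odd) auto
      qed
      then show "coeff T k \<le> coeff T (Suc k)" using diff[of k] by linarith
    qed
  qed
  then show ?thesis
    using sym unimodal_poly_iff_first_half[OF sym] by simp
qed

end
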